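(* Let $A$ be a closed, densely defined linear (possibly unbounded) operator in a Hilbert space $H$ with null space $N$, and let $T=A^*A$, $T_a=T+aI$ for $a>0$. Let $f=Ay$, where $y$ is in the domain of $A$ and $y\perp N$. Let $a:[0,\infty)\to(0,\infty)$ be a monotonically decaying continuous function such that $\lim_{t\to\infty}a(t)=0$ and $\int_0^\infty a(t)\,dt=\infty$. Let $u(t)$, $t\ge0$, be the solution of $$\dot u=-u+T_{a(t)}^{-1}A^*f,\qquad u(0)=0 .$$ Then $\lim_{t\to\infty}u(t)=y$ in the norm of $H$.
   Context: $N=N(A)=\{u: Au=0\}$; $A^*$ is the adjoint of $A$; $T=A^*A\ge0$ is selfadjoint; $I$ is the identity; $\dot u=du/dt$. For constant $a>0$, the operator $T_a^{-1}A^*$ with domain $D(A^* )$ is closable and its closure, again denoted $T_a^{-1}A^*$, is a bounded operator defined on all of $H$ with $\|T_a^{-1}A^*\|\le \frac{1}{2\sqrt a}$ (it is the adjoint of the bounded operator $AT_a^{-1}$). The notation $T_{a(t)}^{-1}A^*f$ refers to this closure. *)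

theory Defs
  imports "HOL-Analysis.Analysis"
begin

text \<open>
  Real and complex Hilbert spaces are treated uniformly. A commutative real normed field with
  multiplicative norm is \<open>\<real>\<close> or \<open>\<complex>\<close> (Gelfand--Mazur), and the last axiom then forces
  \<open>conjugate\<close> to be the identity or complex conjugation.
\<close>

class real_or_complex_field = real_normed_field +
  fixes conjugate :: "'a \<Rightarrow> 'a"
  assumes conjugate_add: "conjugate (x + y) = conjugate x + conjugate y"
    and conjugate_mult: "conjugate (x * y) = conjugate x * conjugate y"
    and conjugate_conjugate: "conjugate (conjugate x) = x"
    and mult_conjugate: "x * conjugate x = (norm x)\<^sup>2 *\<^sub>R 1"

instantiation real :: real_or_complex_field
begin

definition conjugate_real :: "real \<Rightarrow> real" where
  "conjugate_real x = x"

instance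
  by standard (simp_all add: conjugate_real_def power2_eq_square)

end

instantiation complex :: real_or_complex_field
begin

definition conjugate_complex :: "complex \<Rightarrow> complex" where
  "conjugate_complex x = cnj x"

instance
  by standard (simp_all add: conjugate_complex_def complex_norm_square[symmetric] scaleR_conv_of_real)

end

text \<open>
  The norm, the topology, completeness and the real scalar multiplication are those of the type
  class \<open>banach\<close>; \<open>smul_of_real\<close> and \<open>ip_self\<close> tie them to the scalar multiplication \<open>smul\<close>
  and the inner product \<open>ip\<close> (linear in its first argument).
\<close>

locale hilbert_space =
  fixes smul :: "'k::real_or_complex_field \<Rightarrow> 'h::banach \<Rightarrow> 'h"
    and ip :: "'h \<Rightarrow> 'h \<Rightarrow> 'k"
  assumes smul_add_right: "smul c (x + y) = smul c x + smul c y"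
    and smul_add_left: "smul (c + d) x = smul c x + smul d x"
    and smul_smul: "smul c (smul d x) = smul (c * d) x"
    and smul_of_real: "smul (of_real r) x = r *\<^sub>R x"
    and ip_add_left: "ip (x + y) z = ip x z + ip y z"
    and ip_smul_left: "ip (smul c x) z = c * ip x z"
    and ip_conjugate: "ip y x = conjugate (ip x y)"
    and ip_self: "ip x x = of_real ((norm x)\<^sup>2)"

lemma hilbert_space_real_inner:
  "hilbert_space scaleR (inner :: 'h::{real_inner, banach} \<Rightarrow> 'h \<Rightarrow> real)"
  by standard (simp_all add: conjugate_real_def algebra_simps inner_left_distrib
      inner_commute power2_norm_eq_inner)

lemma hilbert_space_complex:
  "hilbert_space (*) (\<lambda>x y :: complex. x * cnj y)"
  by standard (simp_all add: conjugate_complex_def algebra_simps scaleR_conv_of_real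
      complex_norm_square del: of_real_power)

text \<open>
  A partially defined operator is represented by its graph, so that its domain is \<open>Domain A\<close>,
  its inverse is \<open>A\<inverse>\<close>, its closure is the topological \<open>closure A\<close> in \<open>H \<times> H\<close>, and the
  product \<open>B A\<close> (first \<open>A\<close>, then \<open>B\<close>, on its natural domain) is \<open>A O B\<close>.
\<close>

definition linear_operator :: "('k \<Rightarrow> 'h::real_vector \<Rightarrow> 'h) \<Rightarrow> 'h rel \<Rightarrow> bool" where
  "linear_operator smul A \<longleftrightarrow>
     single_valued A \<and> (0, 0) \<in> A \<and>
     (\<forall>x y x' y'. (x, y) \<in> A \<longrightarrow> (x', y') \<in> A \<longrightarrow> (x + x', y + y') \<in> A) \<and>
     (\<forall>c x y. (x, y) \<in> A \<longrightarrow> (smul c x, smul c y) \<in> A)"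

definition densely_defined :: "'h::topological_space rel \<Rightarrow> bool" where
  "densely_defined A \<longleftrightarrow> closure (Domain A) = UNIV"

definition op_apply :: "'h rel \<Rightarrow> 'h \<Rightarrow> 'h" where
  "op_apply A x = (THE y. (x, y) \<in> A)"

definition null_space :: "'h::zero rel \<Rightarrow> 'h set" where
  "null_space A = {x. (x, 0) \<in> A}"

definition adjoint_op :: "('h \<Rightarrow> 'h \<Rightarrow> 'k) \<Rightarrow> 'h rel \<Rightarrow> 'h rel" where
  "adjoint_op ip A = {(v, w). \<forall>(x, z) \<in> A. ip z v = ip x w}"

definition shift_op :: "'h::real_vector rel \<Rightarrow> real \<Rightarrow> 'h rel" where
  "shift_op T a = {(x, z + a *\<^sub>R x) | x z. (x, z) \<in> T}"

definition op_T :: "('h \<Rightarrow> 'h \<Rightarrow> 'k) \<Rightarrow> 'h rel \<Rightarrow> 'h rel" where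
  "op_T ip A = A O adjoint_op ip A"

definition op_Ta_inv_adjoint ::
    "('h::real_normed_vector \<Rightarrow> 'h \<Rightarrow> 'k) \<Rightarrow> 'h rel \<Rightarrow> real \<Rightarrow> 'h rel" where
  "op_Ta_inv_adjoint ip A a = closure (adjoint_op ip A O (shift_op (op_T ip A) a)\<inverse>)"

end

theory Submission
  imports Defs
begin

text \<open>
  Write \<open>f = A y\<close>. The theorem has two independent halves: the regularized solutions
  \<open>x\<^sub>a = T\<^sub>a\<inverse> A\<^sup>* f\<close> converge to \<open>y\<close> as \<open>a\<close> decreases to \<open>0\<close>, and a linear relaxation
  \<open>u' = - u + z(t)\<close> inherits the limit of its forcing term (\<open>relaxation_tendsto\<close>), by
  integrating \<open>(e\<^sup>t (u - y))' = e\<^sup>t (z - y)\<close>. The second half is applied to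
  \<open>z(t) = x\<^sub>b\<close> with \<open>b = a(t)\<close>.

  For the first half, the operators \<open>T\<^sub>a\<inverse> A\<^sup>*\<close> are replaced by the
  variational problem that they solve: \<open>x\<^sub>a\<close> is the minimizer over the domain of \<open>A\<close> of the Tikhonov
  functional \<open>\<parallel>A x - f\<parallel>\<^sup>2 + a \<parallel>x\<parallel>\<^sup>2\<close>. With \<open>g = A x\<close>, its
  Euler equation says that \<open>f - g\<close> lies in the domain of \<open>A\<^sup>*\<close> and \<open>A\<^sup>*(f - g) = a x\<close>, which makes
  sense for every \<open>f\<close> in \<open>H\<close>, and which is \<open>T x + a x = A\<^sup>* f\<close> as soon as \<open>A\<^sup>* f\<close> exists.
  A minimizer exists because \<open>A\<close> is closed (\<open>tikhonov_exists\<close>), and it depends on \<open>f\<close> linearly with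
  \<open>\<parallel>x\<parallel> \<le> \<parallel>f\<parallel> / (2 \<surd>a)\<close> (\<open>tikhonov_bound\<close>).
  As the domain of \<open>A\<^sup>*\<close> is dense, the closure of \<open>T\<^sub>a\<inverse> A\<^sup>*\<close> is the map from \<open>f\<close> to the minimizer
  (\<open>op_apply_Ta_inv_adjoint\<close>).

  All limits in the parameter come from one monotonicity argument. Subtracting the Euler equations
  for two parameters \<open>b \<le> a\<close> gives
  \<open>Re \<langle>a p\<^sub>a - b p\<^sub>b, p\<^sub>a - p\<^sub>b\<rangle> \<le> 0\<close> both for \<open>p = x\<close> and for
  \<open>p = A x\<close>, and this forces
  \<open>\<parallel>p\<^sub>a - p\<^sub>b\<parallel>\<^sup>2 \<le> \<parallel>p\<^sub>b\<parallel>\<^sup>2 - \<parallel>p\<^sub>a\<parallel>\<^sup>2\<close> (\<open>dist_sq_le_of_monotone\<close>).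
  The squared norms are monotone in the parameter, so the family is Cauchy wherever they stay bounded.
  As \<open>a \<rightarrow> \<infinity>\<close> it yields \<open>A x\<^sub>a \<rightarrow> 0\<close> and hence the density of the
  domain of \<open>A\<^sup>*\<close> (\<open>closure_Domain_adjoint_op\<close>). As \<open>a \<rightarrow> 0\<close> it yields a limit \<open>l\<close> of \<open>x\<^sub>a\<close> with
  \<open>A l = f\<close>; since every \<open>x\<^sub>a\<close> is orthogonal to the null space, so is \<open>l\<close>, and
  therefore \<open>l = y\<close> (\<open>tikhonov_tendsto_at_right_0\<close>).
\<close>

section \<open>Convergence of families with controlled oscillation\<close>

lemma convergent_of_vanishing_tail_oscillation:
  fixes p :: "'i::linorder \<Rightarrow> 'h::banach"
  assumes osc: "\<And>s t. i \<le> s \<Longrightarrow> s \<le> t \<Longrightarrow> c * (norm (p s - p t))\<^sup>2 \<le> d s"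
    and "c > 0" and d: "(d \<longlongrightarrow> 0) at_top"
  obtains l where "(p \<longlongrightarrow> l) at_top"
proof -
  have "cauchy_filter (filtermap p at_top)"
    unfolding cauchy_filter_metric_filtermap
  proof (intro allI impI)
    fix e :: real assume "e > 0"
    then have "c * (e/2)\<^sup>2 > 0" using \<open>c > 0\<close> by simp
    then have "eventually (\<lambda>s. i \<le> s \<and> d s < c * (e/2)\<^sup>2) at_top"
      using order_tendstoD(2)[OF d] eventually_ge_at_top eventually_conj by blast
    then obtain s0 where s0: "i \<le> s0" "d s0 < c * (e/2)\<^sup>2"
      by (metis (mono_tags, lifting) eventually_at_top_linorder order_refl)
    have close: "dist (p s0) (p t) < e/2" if "s0 \<le> t" for t
    proof -
      have "c * (norm (p s0 - p t))\<^sup>2 < c * (e/2)\<^sup>2"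
        using osc[OF s0(1) that] s0(2) by simp
      then have "(norm (p s0 - p t))\<^sup>2 < (e/2)\<^sup>2" using \<open>c > 0\<close> by simp
      then have "norm (p s0 - p t) < e/2"
        using \<open>e > 0\<close> by (rule power2_less_imp_less[OF _ less_imp_le[OF half_gt_zero]])
      then show ?thesis by (simp add: dist_norm)
    qed
    then have "dist (p s) (p t) < e" if "s0 \<le> s" "s0 \<le> t" for s t
      using that by (meson dist_commute dist_triangle_half_r)
    then show "\<exists>P. eventually P at_top \<and> (\<forall>x y. P x \<and> P y \<longrightarrow> dist (p x) (p y) < e)"
      using eventually_ge_at_top[of s0] by blast
  qed
  then have "\<exists>l. filtermap p at_top \<le> nhds l"
    by (intro cauchy_filter_complete_converges[OF _ complete_UNIV])
      (simp_all add: filtermap_bot_iff)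
  then show ?thesis using that by (auto simp: filterlim_def)
qed

text \<open>
  The squared oscillation is at most the increment of \<open>\<phi>\<close>, so \<open>\<phi>\<close> increases; being bounded it
  has a supremum, and its distance to the supremum controls the tail.
\<close>

lemma convergent_of_oscillation_le_bounded_increment:
  fixes p :: "real \<Rightarrow> 'h::banach" and \<phi> :: "real \<Rightarrow> real"
  assumes osc: "\<And>s t. 0 < s \<Longrightarrow> s \<le> t \<Longrightarrow> (norm (p s - p t))\<^sup>2 \<le> \<phi> t - \<phi> s"
    and bounded: "\<And>s. 0 < s \<Longrightarrow> \<phi> s \<le> B"
  obtains l where "(p \<longlongrightarrow> l) at_top"
proof -
  define S where "S = (SUP t\<in>{0<..}. \<phi> t)"
  have bdd: "bdd_above (\<phi> ` {0<..})" using bounded by (auto intro: bdd_aboveI2[of _ _ B])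
  have le_S: "\<phi> s \<le> S" if "s > 0" for s
    unfolding S_def using that bdd by (auto intro: cSUP_upper)
  have mono: "\<phi> s \<le> \<phi> t" if "0 < s" "s \<le> t" for s t
    using osc[OF that] by (metis diff_ge_0_iff_ge order_trans zero_le_power2)
  have vanish: "((\<lambda>s. S - \<phi> s) \<longlongrightarrow> 0) at_top"
  proof (rule tendstoI)
    fix e :: real assume "e > 0"
    then have "S - e < S" by simp
    then obtain s0 where s0: "s0 > 0" "S - e < \<phi> s0"
      unfolding S_def using less_cSUP_iff[OF _ bdd] by (metis greaterThan_iff greaterThan_non_empty)
    show "\<forall>\<^sub>F s in at_top. dist (S - \<phi> s) 0 < e"
      using eventually_ge_at_top[of s0]
    proof eventually_elim
      case (elim s)
      then show ?case using s0 mono[of s0 s] le_S[of s] by (simp add: dist_real_def)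
    qed
  qed
  have tail: "1 * (norm (p s - p t))\<^sup>2 \<le> S - \<phi> s" if "1 \<le> s" "s \<le> t" for s t
    using osc[of s t] le_S[of t] that by simp
  obtain l where "(p \<longlongrightarrow> l) at_top"
    by (rule convergent_of_vanishing_tail_oscillation[OF tail zero_less_one vanish])
  then show ?thesis by (rule that)
qed

lemma tendsto_zero_if_norm_sq:
  assumes "((\<lambda>i. (norm (p i))\<^sup>2) \<longlongrightarrow> 0) F"
  shows "(p \<longlongrightarrow> 0) F"
  using tendsto_real_sqrt[OF assms] by (simp add: tendsto_norm_zero_iff)

section \<open>Linear relaxation\<close>

text \<open>
  The solution forgets its initial value at the rate \<open>e\<^sup>-\<^sup>t\<close> and averages the forcing term with
  exponential weights. The mean value inequality for \<open>e\<^sup>t (u - y)\<close> gives this without writing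
  the solution as an integral.
\<close>

lemma relaxation_tendsto:
  fixes u z :: "real \<Rightarrow> 'h::real_normed_vector"
  assumes ode: "\<And>t. t \<ge> 0 \<Longrightarrow> (u has_vector_derivative - u t + z t) (at t within {0..})"
    and z: "(z \<longlongrightarrow> y) at_top"
  shows "(u \<longlongrightarrow> y) at_top"
proof (rule tendstoI)
  fix e :: real assume "e > 0"
  have "\<forall>\<^sub>F t in at_top. dist (z t) y < e/2"
    using tendstoD[OF z, of "e/2"] \<open>e > 0\<close> by simp
  then obtain R0 where R0: "\<And>t. t \<ge> R0 \<Longrightarrow> dist (z t) y < e/2"
    by (auto simp: eventually_at_top_linorder)
  define R where "R = max R0 1"
  have "R > 0" by (simp add: R_def)
  have R: "norm (z t - y) \<le> e/2" if "t \<ge> R" for t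
    using R0[of t] that by (simp add: R_def dist_norm)
  have der: "(u has_vector_derivative - u t + z t) (at t)" if "t > 0" for t
    using ode[of t] that at_within_interior[of t "{0..}"] by (simp add: interior_Ici[of "-1"])
  define v where "v t = exp t *\<^sub>R (u t - y)" for t
  have v': "(v has_vector_derivative exp t *\<^sub>R (z t - y)) (at t)" if "t > 0" for t
    unfolding v_def
    by (rule has_vector_derivative_eq_rhs, (rule derivative_intros der[OF that] | simp)+)
      (simp add: algebra_simps)
  have bound: "norm (u t - y) \<le> exp (R - t) * norm (u R - y) + e/2" if "t > R" for t
  proof -
    have "norm (v t - v R) \<le> e/2 * exp t - e/2 * exp R"
    proof (rule differentiable_bound_general[OF that, where \<phi>' = "\<lambda>s. e/2 * exp s"])
      show "continuous_on {R..t} v"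
        using \<open>R > 0\<close> by (intro continuous_at_imp_continuous_on ballI
            has_vector_derivative_continuous[OF v']) simp
      show "norm (exp s *\<^sub>R (z s - y)) \<le> e/2 * exp s" if "R < s" for s
        using R[of s] that by (simp add: mult.commute)
    qed (use v' \<open>R > 0\<close> in \<open>auto intro!: continuous_intros derivative_eq_intros
           simp flip: has_real_derivative_iff_has_vector_derivative\<close>)
    moreover have "e/2 * exp R > 0" using \<open>e > 0\<close> by simp
    ultimately have "norm (v t) \<le> norm (v R) + e/2 * exp t"
      using norm_triangle_sub[of "v t" "v R"] by linarith
    then have "exp t * norm (u t - y) \<le> exp R * norm (u R - y) + e/2 * exp t"
      unfolding v_def norm_scaleR by simp
    also have "exp R * norm (u R - y) + e/2 * exp t
        = exp t * (exp (R - t) * norm (u R - y) + e/2)"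
      by (simp add: distrib_left mult_exp_exp flip: mult.assoc)
    finally show ?thesis by simp
  qed
  have "((\<lambda>t. (exp R * norm (u R - y)) * inverse (exp t)) \<longlongrightarrow> 0) (at_top :: real filter)"
    by (intro tendsto_mult_right_zero tendsto_inverse_0_at_top exp_at_top)
  then have "((\<lambda>t. exp (R - t) * norm (u R - y)) \<longlongrightarrow> 0) at_top"
    by (simp add: exp_diff divide_inverse mult_ac)
  then have "\<forall>\<^sub>F t in at_top. exp (R - t) * norm (u R - y) < e/2"
    using order_tendstoD(2)[of _ 0 _ "e/2"] \<open>e > 0\<close> by simp
  then show "\<forall>\<^sub>F t in at_top. dist (u t) y < e"
    using eventually_gt_at_top[of R]
  proof eventually_elim
    case (elim t)
    then show ?case using bound[of t] by (simp add: dist_norm)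
  qed
qed

section \<open>The real inner product underlying a Hilbert space\<close>

context hilbert_space
begin

text \<open>
  By polarization this is the real part of \<open>ip\<close>. Defining it from the norm gives a
  real-valued function over the abstract scalar field, which has no real-part map of its own; the
  lemma \<open>of_real_re_ip\<close> recovers the usual formula.
\<close>

definition re_ip :: "'h \<Rightarrow> 'h \<Rightarrow> real" where
  "re_ip x y = ((norm (x + y))\<^sup>2 - (norm x)\<^sup>2 - (norm y)\<^sup>2) / 2"

lemma conjugate_of_real: "conjugate (of_real r :: 'k) = of_real r"
proof (cases "r = 0")
  case True
  have "conjugate (0 :: 'k) + conjugate 0 = conjugate 0" by (simp flip: conjugate_add)
  then show ?thesis using True by simp
next
  case False
  have "of_real r * conjugate (of_real r :: 'k) = of_real r * of_real r"
    by (simp add: mult_conjugate of_real_def power2_eq_square)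
  then show ?thesis using False by simp
qed

lemma ip_add_right: "ip x (y + z) = ip x y + ip x z"
  by (metis ip_add_left ip_conjugate conjugate_add)

lemma ip_scaleR_left: "ip (r *\<^sub>R x) y = of_real r * ip x y"
  by (metis ip_smul_left smul_of_real)

lemma ip_scaleR_right: "ip x (r *\<^sub>R y) = of_real r * ip x y"
  by (metis ip_conjugate ip_scaleR_left conjugate_mult conjugate_of_real)

lemma of_real_re_ip: "of_real (2 * re_ip x y) = ip x y + ip y x"
proof -
  have "(of_real ((norm (x + y))\<^sup>2) :: 'k) = of_real ((norm x)\<^sup>2) + ip x y + (ip y x + of_real ((norm y)\<^sup>2))"
    by (simp only: ip_self[symmetric] ip_add_left ip_add_right) (simp add: algebra_simps)
  then show ?thesis by (simp add: re_ip_def)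
qed

lemma re_ip_commute: "re_ip x y = re_ip y x"
  by (simp add: re_ip_def add.commute)

lemma re_ip_self: "re_ip x x = (norm x)\<^sup>2"
  by (simp add: re_ip_def power_mult_distrib flip: scaleR_2)

lemma re_ip_add_left: "re_ip (x + y) z = re_ip x z + re_ip y z"
proof -
  have "(of_real (2 * re_ip (x + y) z) :: 'k) = of_real (2 * re_ip x z + 2 * re_ip y z)"
    unfolding of_real_add of_real_re_ip by (simp add: ip_add_left ip_add_right)
  then show ?thesis by (simp only: of_real_eq_iff)
qed

lemma re_ip_scaleR_left: "re_ip (r *\<^sub>R x) y = r * re_ip x y"
proof -
  have "(of_real (2 * re_ip (r *\<^sub>R x) y) :: 'k) = of_real (r * (2 * re_ip x y))"
    unfolding of_real_mult[of r] of_real_re_ip 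
    by (simp add: ip_scaleR_left ip_scaleR_right algebra_simps)
  then show ?thesis by (simp only: of_real_eq_iff)
qed

lemma re_ip_minus_left: "re_ip (- x) y = - re_ip x y"
  using re_ip_scaleR_left[of "-1"] by simp

lemma re_ip_diff_left: "re_ip (x - y) z = re_ip x z - re_ip y z"
  using re_ip_add_left[of x "- y"] by (simp add: re_ip_minus_left)

lemma re_ip_add_right: "re_ip z (x + y) = re_ip z x + re_ip z y"
  by (metis re_ip_add_left re_ip_commute)

lemma re_ip_diff_right: "re_ip z (x - y) = re_ip z x - re_ip z y"
  by (metis re_ip_diff_left re_ip_commute)

lemma re_ip_scaleR_right: "re_ip x (r *\<^sub>R y) = r * re_ip x y"
  by (metis re_ip_scaleR_left re_ip_commute)

lemma re_ip_zero [simp]: "re_ip 0 x = 0" "re_ip x 0 = 0"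
  by (simp_all add: re_ip_def)

lemmas re_ip_simps = re_ip_add_left re_ip_diff_left re_ip_add_right re_ip_diff_right
  re_ip_scaleR_left re_ip_scaleR_right

lemma norm_add_sq: "(norm (x + y))\<^sup>2 = (norm x)\<^sup>2 + 2 * re_ip x y + (norm y)\<^sup>2"
  by (simp add: re_ip_def field_simps)

lemma norm_diff_sq: "(norm (x - y))\<^sup>2 = (norm x)\<^sup>2 - 2 * re_ip x y + (norm y)\<^sup>2"
  by (simp add: re_ip_simps re_ip_commute flip: re_ip_self)

lemma re_ip_le_norm_mult: "re_ip x y \<le> norm x * norm y"
proof -
  have "(norm (x + y))\<^sup>2 \<le> (norm x + norm y)\<^sup>2"
    by (intro power_mono norm_triangle_ineq) simp
  then show ?thesis by (simp add: re_ip_def power2_sum)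
qed

lemma tendsto_re_ip [tendsto_intros]:
  "(p \<longlongrightarrow> x) F \<Longrightarrow> (q \<longlongrightarrow> y) F \<Longrightarrow> ((\<lambda>i. re_ip (p i) (q i)) \<longlongrightarrow> re_ip x y) F"
  unfolding re_ip_def by (intro tendsto_intros) auto

section \<open>Operators and adjoints in terms of the real inner product\<close>

lemma linear_operator_add:
  "linear_operator smul A \<Longrightarrow> (x, p) \<in> A \<Longrightarrow> (x', p') \<in> A \<Longrightarrow> (x + x', p + p') \<in> A"
  unfolding linear_operator_def by blast

lemma linear_operator_scaleR:
  "linear_operator smul A \<Longrightarrow> (x, p) \<in> A \<Longrightarrow> (r *\<^sub>R x, r *\<^sub>R p) \<in> A"
  unfolding linear_operator_def by (metis smul_of_real)

lemma linear_operator_diff: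
  "linear_operator smul A \<Longrightarrow> (x, p) \<in> A \<Longrightarrow> (x', p') \<in> A \<Longrightarrow> (x - x', p - p') \<in> A"
  using linear_operator_add[of A x p "- x'" "- p'"] linear_operator_scaleR[of A x' p' "-1"] by simp

text \<open>
  Passing to real parts loses nothing because the graph of \<open>A\<close> is stable under all
  scalars: multiplying a pair of \<open>A\<close> by the conjugate of the defect
  \<open>ip p v - ip x w\<close> turns the defect into its squared modulus, which is real.
\<close>

lemma adjoint_op_iff_re_ip:
  assumes "linear_operator smul A"
  shows "(v, w) \<in> adjoint_op ip A \<longleftrightarrow> (\<forall>(x, p) \<in> A. re_ip p v = re_ip x w)"
proof
  assume L: "(v, w) \<in> adjoint_op ip A"
  have "re_ip p v = re_ip x w" if "(x, p) \<in> A" for x p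
  proof -
    have "ip p v = ip x w" using L that by (auto simp: adjoint_op_def)
    then have "(of_real (2 * re_ip p v) :: 'k) = of_real (2 * re_ip x w)"
      unfolding of_real_re_ip by (metis ip_conjugate)
    then show ?thesis by (simp only: of_real_eq_iff)
  qed
  then show "\<forall>(x, p) \<in> A. re_ip p v = re_ip x w" by blast
next
  assume R: "\<forall>(x, p) \<in> A. re_ip p v = re_ip x w"
  have "ip p v = ip x w" if "(x, p) \<in> A" for x p
  proof -
    define d where "d = ip p v - ip x w"
    define c where "c = conjugate d"
    have cd: "c * d = of_real ((norm d)\<^sup>2)"
      using mult_conjugate[of d] by (simp add: c_def of_real_def mult.commute)
    have "(smul c x, smul c p) \<in> A" using assms that unfolding linear_operator_def by blast
    then have "re_ip (smul c p) v = re_ip (smul c x) w" using R by blast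
    then have "ip (smul c p) v + conjugate (ip (smul c p) v)
             = ip (smul c x) w + conjugate (ip (smul c x) w)"
      by (metis of_real_re_ip ip_conjugate)
    moreover have "ip (smul c p) v = ip (smul c x) w + c * d"
      by (simp add: ip_smul_left d_def algebra_simps)
    ultimately have "c * d + conjugate (c * d) = 0"
      by (simp add: conjugate_add)
    then have "(of_real (2 * (norm d)\<^sup>2) :: 'k) = of_real 0"
      unfolding cd conjugate_of_real by simp
    then have "d = 0" by (simp only: of_real_eq_iff) simp
    then show ?thesis by (simp add: d_def)
  qed
  then show "(v, w) \<in> adjoint_op ip A" by (auto simp: adjoint_op_def)
qed

lemma adjoint_op_diff:
  assumes lin: "linear_operator smul A"
    and "(v, w) \<in> adjoint_op ip A" "(v', w') \<in> adjoint_op ip A"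
  shows "(v - v', w - w') \<in> adjoint_op ip A"
  using assms(2,3) unfolding adjoint_op_iff_re_ip[OF lin] by (simp add: re_ip_diff_right case_prod_beta)

section \<open>The Tikhonov problem\<close>

text \<open>
  This is the Euler equation of the functional \<open>\<parallel>A x - f\<parallel>\<^sup>2 + a \<parallel>x\<parallel>\<^sup>2\<close> at \<open>x\<close>, with
  \<open>g = A x\<close>. Only \<open>f - g\<close> has to lie in the domain of the adjoint, so \<open>f\<close> is arbitrary.
\<close>

definition tikhonov :: "'h rel \<Rightarrow> real \<Rightarrow> 'h \<Rightarrow> 'h \<Rightarrow> 'h \<Rightarrow> bool" where
  "tikhonov A a f x g \<longleftrightarrow> (x, g) \<in> A \<and> (f - g, a *\<^sub>R x) \<in> adjoint_op ip A"

lemma tikhonov_iff: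
  assumes "linear_operator smul A"
  shows "tikhonov A a f x g \<longleftrightarrow>
    (x, g) \<in> A \<and> (\<forall>(z, p) \<in> A. re_ip p (f - g) = a * re_ip z x)"
  unfolding tikhonov_def adjoint_op_iff_re_ip[OF assms] by (simp add: re_ip_scaleR_right)

lemma tikhonov_variation:
  assumes "linear_operator smul A" "tikhonov A a f x g" "(z, p) \<in> A"
  shows "re_ip p (f - g) = a * re_ip z x"
  using assms(2,3) unfolding tikhonov_iff[OF assms(1)] by blast

lemma tikhonov_diff:
  assumes lin: "linear_operator smul A" and "tikhonov A a f x g" "tikhonov A a f' x' g'"
  shows "tikhonov A a (f - f') (x - x') (g - g')"
proof -
  have "re_ip p ((f - f') - (g - g')) = a * re_ip z (x - x')" if "(z, p) \<in> A" for z p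
    using tikhonov_variation[OF lin assms(2) that] tikhonov_variation[OF lin assms(3) that]
    by (simp add: re_ip_diff_right right_diff_distrib)
  then show ?thesis
    using assms(2,3) linear_operator_diff[OF lin] by (auto simp: tikhonov_iff[OF lin])
qed

lemma tikhonov_energy:
  assumes lin: "linear_operator smul A" and tik: "tikhonov A a f x g"
  shows "re_ip f g = (norm g)\<^sup>2 + a * (norm x)\<^sup>2"
proof -
  have "re_ip g (f - g) = a * re_ip x x"
    using tikhonov_variation[OF lin tik] tik by (simp add: tikhonov_def)
  then show ?thesis by (simp add: re_ip_diff_right re_ip_self re_ip_commute)
qed

text \<open>
  This is the norm bound \<open>\<parallel>T\<^sub>a\<inverse> A\<^sup>*\<parallel> \<le> 1 / (2 \<surd>a)\<close>.
  It follows from the energy identity by completing the square in \<open>f - 2 g\<close>.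
\<close>

lemma tikhonov_bound:
  assumes "linear_operator smul A" "tikhonov A a f x g"
  shows "4 * a * (norm x)\<^sup>2 \<le> (norm f)\<^sup>2"
proof -
  have "0 \<le> (norm (f - 2 *\<^sub>R g))\<^sup>2" by simp
  also have "\<dots> = (norm f)\<^sup>2 - 4 * re_ip f g + 4 * (norm g)\<^sup>2"
    by (simp add: norm_diff_sq re_ip_scaleR_right power_mult_distrib)
  finally show ?thesis using tikhonov_energy[OF assms] by simp
qed

text \<open>
  The functional is a weighted squared distance from \<open>(0, f)\<close> to points of the graph, so the
  parallelogram law makes every minimizing sequence Cauchy, and its limit stays in the closed graph.
  The first variation at the minimizer is the Euler equation.
\<close>

lemma tikhonov_exists:
  assumes lin: "linear_operator smul A" and "closed A" and "a > 0"
  obtains x g where "tikhonov A a f x g"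
proof -
  define J where "J = (\<lambda>(x :: 'h, p). (norm (p - f))\<^sup>2 + a * (norm x)\<^sup>2)"
  define m where "m = Inf (J ` A)"
  have J_ge: "J w \<ge> 0" for w using \<open>a > 0\<close> by (auto simp: J_def split: prod.splits)
  then have bdd: "bdd_below (J ` A)" by (auto intro: bdd_belowI2[of _ 0])
  have m_le: "m \<le> J w" if "w \<in> A" for w
    unfolding m_def using that bdd by (auto intro: cINF_lower)
  have ne: "A \<noteq> {}" using lin by (auto simp: linear_operator_def)
  define \<epsilon> :: "nat \<Rightarrow> real" where "\<epsilon> = (\<lambda>n. inverse (real (Suc n)))"
  have \<epsilon>_pos: "\<epsilon> n > 0" for n by (simp add: \<epsilon>_def)
  have \<epsilon>_antimono: "\<epsilon> k \<le> \<epsilon> n" if "n \<le> k" for n k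
    using that unfolding \<epsilon>_def by (intro le_imp_inverse_le) auto
  have \<epsilon>_lim: "\<epsilon> \<longlonglongrightarrow> 0"
    unfolding \<epsilon>_def by (rule LIMSEQ_inverse_real_of_nat)
  have "\<exists>w\<in>A. J w < m + \<epsilon> n" for n
    using cINF_less_iff[OF ne bdd, of "m + \<epsilon> n"] \<epsilon>_pos[of n] by (simp add: m_def)
  then obtain W where W: "\<And>n. W n \<in> A" "\<And>n. J (W n) < m + \<epsilon> n"
    by metis
  define X where "X n = fst (W n)" for n
  define P where "P n = snd (W n)" for n
  have XP: "W n = (X n, P n)" for n by (simp add: X_def P_def)
  have parallelogram: "(norm (p - p'))\<^sup>2 + a * (norm (x - x'))\<^sup>2 \<le> 2 * (J (x, p) + J (x', p') - 2 * m)"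
    if "(x, p) \<in> A" "(x', p') \<in> A" for x p x' p'
  proof -
    have half: "(norm ((1/2) *\<^sub>R (v + v')))\<^sup>2 = ((norm v)\<^sup>2 + (norm v')\<^sup>2)/2 - (norm (v - v'))\<^sup>2/4"
      for v v' :: 'h
    proof -
      have "(norm ((1/2) *\<^sub>R (v + v')))\<^sup>2 = (norm (v + v'))\<^sup>2 / 4"
        by (simp add: power_divide)
      then show ?thesis using norm_add_sq[of v v'] norm_diff_sq[of v v'] by argo
    qed
    have "m \<le> J ((1/2) *\<^sub>R (x + x'), (1/2) *\<^sub>R (p + p'))"
      using m_le linear_operator_scaleR[OF lin linear_operator_add[OF lin that]] by blast
    moreover have "(1/2) *\<^sub>R (p + p') - f = (1/2) *\<^sub>R ((p - f) + (p' - f))"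
    proof -
      have "(p - f) + (p' - f) = (p + p') - (f + f)" by simp
      then show ?thesis by (simp only: scaleR_diff_right scaleR_half_double)
    qed
    ultimately have "m \<le> (norm ((1/2) *\<^sub>R ((p - f) + (p' - f))))\<^sup>2
        + a * (norm ((1/2) *\<^sub>R (x + x')))\<^sup>2" by (simp add: J_def)
    then show ?thesis
      unfolding half by (simp add: J_def distrib_left right_diff_distrib add_divide_distrib)
  qed
  have osc: "(norm (P n - P k))\<^sup>2 + a * (norm (X n - X k))\<^sup>2 \<le> 4 * \<epsilon> n"
    if "n \<le> k" for n k
  proof -
    have "(norm (P n - P k))\<^sup>2 + a * (norm (X n - X k))\<^sup>2
        \<le> 2 * (J (X n, P n) + J (X k, P k) - 2 * m)"
      using W(1)[of n] W(1)[of k] unfolding XP by (rule parallelogram)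
    also have "\<dots> \<le> 4 * \<epsilon> n"
      using W(2)[of n] W(2)[of k] \<epsilon>_antimono[OF that] unfolding XP by argo
    finally show ?thesis .
  qed
  have lim0: "((\<lambda>n. 4 * \<epsilon> n) \<longlongrightarrow> 0) at_top"
    using tendsto_mult_right_zero[OF \<epsilon>_lim] .
  obtain g where g: "P \<longlonglongrightarrow> g"
  proof (rule convergent_of_vanishing_tail_oscillation[OF _ _ lim0, of 0 1 P])
    show "1 * (norm (P s - P t))\<^sup>2 \<le> 4 * \<epsilon> s" if "s \<le> t" for s t
      using osc[OF that] \<open>a > 0\<close> by (smt (verit) mult_nonneg_nonneg zero_le_power2)
  qed auto
  obtain x where x: "X \<longlonglongrightarrow> x"
  proof (rule convergent_of_vanishing_tail_oscillation[OF _ _ lim0, of 0 a X])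
    show "a * (norm (X s - X t))\<^sup>2 \<le> 4 * \<epsilon> s" if "s \<le> t" for s t
      using osc[OF that] by (smt (verit) zero_le_power2)
  qed (use \<open>a > 0\<close> in auto)
  have "(x, g) \<in> A"
    using closed_sequentially[OF \<open>closed A\<close> _ tendsto_Pair[OF x g]] W(1) unfolding XP by blast
  have "J (x, g) \<le> m"
  proof (rule LIMSEQ_le)
    show "(\<lambda>n. J (X n, P n)) \<longlonglongrightarrow> J (x, g)"
      unfolding J_def by (auto intro!: tendsto_intros x g)
    show "(\<lambda>n. m + \<epsilon> n) \<longlonglongrightarrow> m"
      using tendsto_add[OF tendsto_const \<epsilon>_lim, of m] by simp
    show "\<exists>N. \<forall>n\<ge>N. J (X n, P n) \<le> m + \<epsilon> n"
      using W(2) unfolding XP by (meson less_imp_le)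
  qed
  have "re_ip p (f - g) = a * re_ip z x" if "(z, p) \<in> A" for z p
  proof -
    define b where "b = re_ip (g - f) p + a * re_ip x z"
    define c where "c = (norm p)\<^sup>2 + a * (norm z)\<^sup>2"
    have quad: "0 \<le> 2 * s * b + s\<^sup>2 * c" for s
    proof -
      have "J (x, g) \<le> J (x + s *\<^sub>R z, g + s *\<^sub>R p)"
        using \<open>J (x, g) \<le> m\<close> m_le linear_operator_add[OF lin \<open>(x, g) \<in> A\<close>]
          linear_operator_scaleR[OF lin that] order_trans by blast
      moreover have expand: "(norm (v + s *\<^sub>R w))\<^sup>2 = (norm v)\<^sup>2 + 2 * s * re_ip v w + s\<^sup>2 * (norm w)\<^sup>2"
        for v w by (simp add: norm_add_sq re_ip_scaleR_right power_mult_distrib)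
      moreover have "g + s *\<^sub>R p - f = (g - f) + s *\<^sub>R p" by simp
      ultimately show ?thesis
        by (simp add: J_def b_def c_def distrib_left mult.left_commute)
    qed
    have "c \<ge> 0" using \<open>a > 0\<close> by (simp add: c_def)
    \<comment> \<open>The minimum of the quadratic is at \<open>- b / c\<close>; the shift by one avoids \<open>c = 0\<close> and still makes
      its value negative unless \<open>b = 0\<close>.\<close>
    define s where "s = - b / (c + 1)"
    then have b: "b = - (s * (c + 1))" using \<open>c \<ge> 0\<close> by simp
    have "2 * s * b + s\<^sup>2 * c = - (s\<^sup>2 * (c + 2))"
      unfolding b by (simp add: power2_eq_square algebra_simps)
    then have "s\<^sup>2 * (c + 2) \<le> 0" using quad[of s] by simp
    then have "s = 0" using \<open>c \<ge> 0\<close> by (simp add: mult_le_0_iff)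
    then have "b = 0" using b by simp
    then show ?thesis 
      using re_ip_commute[of p "g - f"] re_ip_commute[of x z] by (simp add: b_def re_ip_diff_right)
  qed
  then have "tikhonov A a f x g" using \<open>(x, g) \<in> A\<close> by (auto simp: tikhonov_iff[OF lin])
  then show ?thesis by (rule that)
qed

section \<open>Monotone dependence on the regularization parameter\<close>

text \<open>
  Splitting \<open>a p - b q = b (p - q) + (a - b) p\<close> shows \<open>re_ip p (p - q) \<le> 0\<close> when \<open>b < a\<close>, that is,
  the triangle \<open>0, p, q\<close> has no acute angle at \<open>p\<close>.
\<close>

lemma dist_sq_le_of_monotone:
  assumes "0 < b" "b \<le> a" and mon: "re_ip (a *\<^sub>R p - b *\<^sub>R q) (p - q) \<le> 0"
  shows "(norm (p - q))\<^sup>2 \<le> (norm q)\<^sup>2 - (norm p)\<^sup>2"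
proof -
  have "a *\<^sub>R p - b *\<^sub>R q = b *\<^sub>R (p - q) + (a - b) *\<^sub>R p" by (simp add: algebra_simps)
  then have *: "b * (norm (p - q))\<^sup>2 + (a - b) * re_ip p (p - q) \<le> 0"
    using mon by (simp add: re_ip_add_left re_ip_scaleR_left re_ip_self)
  show ?thesis
  proof (cases "a = b")
    case True
    then have "p = q" using * \<open>0 < b\<close> by (simp add: mult_le_0_iff)
    then show ?thesis by simp
  next
    case False
    have "b * (norm (p - q))\<^sup>2 \<ge> 0" using \<open>0 < b\<close> by simp
    then have "re_ip p (p - q) \<le> 0"
      using * False assms(2) by (smt (verit) mult_pos_pos)
    then show ?thesis by (simp add: norm_diff_sq re_ip_diff_right re_ip_self)
  qed
qed

text \<open>
  The Euler equations, tested with \<open>x - z\<close>, turn the pairing into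
  \<open>- \<parallel>A (x - z)\<parallel>\<^sup>2\<close>.
\<close>

lemma tikhonov_solution_osc:
  assumes lin: "linear_operator smul A" and "tikhonov A a f x g" "tikhonov A b f z h" "0 < b" "b \<le> a"
  shows "(norm (x - z))\<^sup>2 \<le> (norm z)\<^sup>2 - (norm x)\<^sup>2"
proof (rule dist_sq_le_of_monotone[OF assms(4,5)])
  have "(x - z, g - h) \<in> A" using assms linear_operator_diff[OF lin] by (auto simp: tikhonov_def)
  then have "re_ip (g - h) (f - g) = a * re_ip (x - z) x" "re_ip (g - h) (f - h) = b * re_ip (x - z) z"
    by (rule tikhonov_variation[OF lin assms(2)], rule tikhonov_variation[OF lin assms(3)])
  then have "re_ip (a *\<^sub>R x - b *\<^sub>R z) (x - z) = - (norm (g - h))\<^sup>2"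
    unfolding re_ip_commute[of "a *\<^sub>R x - b *\<^sub>R z"] by (simp add: re_ip_simps flip: re_ip_self)
  then show "re_ip (a *\<^sub>R x - b *\<^sub>R z) (x - z) \<le> 0" by simp
qed

text \<open>
  The same estimate holds for the images under \<open>A\<close>: here the Euler equations are tested with
  \<open>a x - b z\<close>, and the pairing becomes \<open>- \<parallel>a x - b z\<parallel>\<^sup>2\<close>.
\<close>

lemma tikhonov_image_osc:
  assumes lin: "linear_operator smul A" and "tikhonov A a f x g" "tikhonov A b f z h" "0 < b" "b \<le> a"
  shows "(norm (g - h))\<^sup>2 \<le> (norm h)\<^sup>2 - (norm g)\<^sup>2"
proof (rule dist_sq_le_of_monotone[OF assms(4,5)])
  let ?w = "a *\<^sub>R x - b *\<^sub>R z" and ?r = "a *\<^sub>R g - b *\<^sub>R h"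
  have "(?w, ?r) \<in> A"
    using assms linear_operator_diff[OF lin] linear_operator_scaleR[OF lin]
    by (auto simp: tikhonov_def)
  then have "re_ip ?r (f - g) = a * re_ip ?w x" "re_ip ?r (f - h) = b * re_ip ?w z"
    by (rule tikhonov_variation[OF lin assms(2)], rule tikhonov_variation[OF lin assms(3)])
  then have "re_ip ?r (g - h) = - re_ip ?w ?w"
    by (simp add: re_ip_diff_right re_ip_scaleR_right)
  then show "re_ip ?r (g - h) \<le> 0" by (simp add: re_ip_self)
qed

section \<open>The closure of the regularized inverse\<close>

text \<open>
  The points \<open>f - g\<^sub>s\<close> lie in the domain of the adjoint, and \<open>g\<^sub>s \<rightarrow> 0\<close> as \<open>s \<rightarrow> \<infinity>\<close>: the \<open>g\<^sub>s\<close>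
  converge since their norms decrease, and \<open>x\<^sub>s \<rightarrow> 0\<close>, so the closedness and single-valuedness
  of \<open>A\<close> leave only the limit \<open>0\<close>.
\<close>

lemma closure_Domain_adjoint_op:
  assumes lin: "linear_operator smul A" and "closed A"
  shows "f \<in> closure (Domain (adjoint_op ip A))"
proof -
  have "\<exists>x g. tikhonov A s f x g" if "s > 0" for s
    using tikhonov_exists[OF assms that] by blast
  then obtain x g where tik: "\<And>s. s > 0 \<Longrightarrow> tikhonov A s f (x s) (g s)" by metis
  obtain l where l: "(g \<longlongrightarrow> l) at_top"
  proof (rule convergent_of_oscillation_le_bounded_increment[where p = g and \<phi> = "\<lambda>s. - (norm (g s))\<^sup>2"])
    show "(norm (g s - g t))\<^sup>2 \<le> - (norm (g t))\<^sup>2 - - (norm (g s))\<^sup>2" if "0 < s" "s \<le> t" for s t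
      using tikhonov_image_osc[OF lin tik tik that] that by (simp add: norm_minus_commute)
    show "- (norm (g s))\<^sup>2 \<le> 0" for s by simp
  qed
  have "((\<lambda>s. (norm (x s))\<^sup>2) \<longlongrightarrow> 0) at_top"
  proof (rule tendsto_sandwich[OF _ _ tendsto_const])
    show "\<forall>\<^sub>F s in at_top. 0 \<le> (norm (x s))\<^sup>2" by simp
    show "\<forall>\<^sub>F s in at_top. (norm (x s))\<^sup>2 \<le> (norm f)\<^sup>2 / 4 * inverse s"
      using eventually_gt_at_top[of 0]
    proof eventually_elim
      case (elim s)
      then show ?case using tikhonov_bound[OF lin tik[OF elim]] by (simp add: field_simps)
    qed
    show "((\<lambda>s. (norm f)\<^sup>2 / 4 * inverse s) \<longlongrightarrow> 0) (at_top :: real filter)"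
      by (intro tendsto_mult_right_zero tendsto_inverse_0_at_top filterlim_ident)
  qed
  then have x: "(x \<longlongrightarrow> 0) at_top"
    by (rule tendsto_zero_if_norm_sq)
  have "(0, l) \<in> A"
    by (rule Lim_in_closed_set[OF \<open>closed A\<close> _ _ tendsto_Pair[OF x l]])
      (use tik in \<open>auto intro!: eventually_at_top_linorderI[of 1] simp: tikhonov_def\<close>)
  then have "l = 0" using lin by (auto simp: linear_operator_def single_valued_def)
  then have "((\<lambda>s. f - g s) \<longlongrightarrow> f) at_top" using tendsto_diff[OF tendsto_const l] by simp
  moreover have "\<forall>\<^sub>F s in at_top. f - g s \<in> Domain (adjoint_op ip A)"
    using eventually_gt_at_top[of 0] by eventually_elim (use tik in \<open>auto simp: tikhonov_def\<close>)
  ultimately show ?thesis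
    using Lim_in_closed_set[OF closed_closure] closure_subset
    by (smt (verit, best) eventually_mono subsetD trivial_limit_at_top_linorder)
qed

lemma Ta_inv_adjoint_iff:
  assumes lin: "linear_operator smul A"
  shows "(f, x) \<in> adjoint_op ip A O (shift_op (op_T ip A) a)\<inverse> \<longleftrightarrow>
    f \<in> Domain (adjoint_op ip A) \<and> (\<exists>g. tikhonov A a f x g)"
proof
  assume "(f, x) \<in> adjoint_op ip A O (shift_op (op_T ip A) a)\<inverse>"
  then obtain h g r where "(f, h) \<in> adjoint_op ip A" "(x, g) \<in> A" "(g, r) \<in> adjoint_op ip A"
    "h = r + a *\<^sub>R x" by (auto simp: shift_op_def op_T_def)
  moreover from this have "(f - g, a *\<^sub>R x) \<in> adjoint_op ip A"
    using adjoint_op_diff[OF lin, of f h g r] by simp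
  ultimately show "f \<in> Domain (adjoint_op ip A) \<and> (\<exists>g. tikhonov A a f x g)"
    unfolding tikhonov_def by blast
next
  assume "f \<in> Domain (adjoint_op ip A) \<and> (\<exists>g. tikhonov A a f x g)"
  then obtain h g where h: "(f, h) \<in> adjoint_op ip A" and g: "tikhonov A a f x g" by blast
  have "(g, h - a *\<^sub>R x) \<in> adjoint_op ip A"
    using adjoint_op_diff[OF lin h, of "f - g" "a *\<^sub>R x"] g by (simp add: tikhonov_def)
  then have "(x, h - a *\<^sub>R x) \<in> op_T ip A" using g by (auto simp: op_T_def tikhonov_def)
  then have "(x, h) \<in> shift_op (op_T ip A) a" unfolding shift_op_def by force
  then show "(f, x) \<in> adjoint_op ip A O (shift_op (op_T ip A) a)\<inverse>" using h by blast
qed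

text \<open>
  By the norm bound the minimizer depends continuously on \<open>f\<close>. Hence any approximation of \<open>f\<close>
  from the dense domain of the adjoint carries the minimizers along: this shows both that the closure
  contains \<open>(f, x)\<close> and that it contains no other value at \<open>f\<close>.
\<close>

lemma op_apply_Ta_inv_adjoint:
  assumes lin: "linear_operator smul A" and "closed A" and "a > 0" and tik: "tikhonov A a f x g"
  shows "op_apply (op_Ta_inv_adjoint ip A a) f = x"
proof -
  let ?G = "adjoint_op ip A O (shift_op (op_T ip A) a)\<inverse>"
  have tendsto: "X \<longlonglongrightarrow> x" if F: "F \<longlonglongrightarrow> f" and X: "\<And>n. \<exists>g. tikhonov A a (F n) (X n) g" for F X
  proof -
    have bd: "(norm (X n - x))\<^sup>2 \<le> (norm (F n - f))\<^sup>2 / (4 * a)" for n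
    proof -
      obtain g' where "tikhonov A a (F n) (X n) g'" using X by blast
      from tikhonov_bound[OF lin tikhonov_diff[OF lin this tik]]
      show ?thesis using \<open>a > 0\<close> by (simp add: field_simps)
    qed
    have bound_lim: "(\<lambda>n. (norm (F n - f))\<^sup>2 / (4 * a)) \<longlonglongrightarrow> 0"
    proof -
      have "(\<lambda>n. norm (F n - f)) \<longlonglongrightarrow> 0"
        by (rule tendsto_norm_zero[OF LIM_zero[OF F]])
      then have "(\<lambda>n. (norm (F n - f))\<^sup>2) \<longlonglongrightarrow> 0" by (rule tendsto_null_power) simp
      then show ?thesis by (rule tendsto_divide_zero)
    qed
    have "(\<lambda>n. (norm (X n - x))\<^sup>2) \<longlonglongrightarrow> 0"
      by (rule tendsto_sandwich[OF _ _ tendsto_const bound_lim]) (use bd in auto)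
    then have "(\<lambda>n. X n - x) \<longlonglongrightarrow> 0" by (rule tendsto_zero_if_norm_sq)
    then show ?thesis by (rule LIM_zero_cancel)
  qed
  have "(f, x) \<in> closure ?G"
  proof -
    obtain F where F: "\<And>n. F n \<in> Domain (adjoint_op ip A)" "F \<longlonglongrightarrow> f"
      using closure_Domain_adjoint_op[OF assms(1,2), of f] unfolding closure_sequential by blast
    have "\<exists>x g. tikhonov A a (F n) x g" for n using tikhonov_exists[OF assms(1-3)] by blast
    then obtain X where X: "\<And>n. \<exists>g. tikhonov A a (F n) (X n) g" by metis
    have in_G: "(F n, X n) \<in> ?G" for n
      unfolding Ta_inv_adjoint_iff[OF lin] using F(1) X by blast
    have "(\<lambda>n. (F n, X n)) \<longlonglongrightarrow> (f, x)"
      by (rule tendsto_Pair[OF F(2) tendsto[OF F(2) X]])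
    then show ?thesis
      unfolding closure_sequential using in_G by (intro exI[of _ "\<lambda>n. (F n, X n)"]) simp
  qed
  moreover have "x' = x" if x': "(f, x') \<in> closure ?G" for x'
  proof -
    obtain W where W: "\<And>n. W n \<in> ?G" "W \<longlonglongrightarrow> (f, x')"
      using x' unfolding closure_sequential by blast
    have "(\<lambda>n. snd (W n)) \<longlonglongrightarrow> x"
    proof (rule tendsto)
      show "(\<lambda>n. fst (W n)) \<longlonglongrightarrow> f" using tendsto_fst[OF W(2)] by simp
      show "\<exists>g. tikhonov A a (fst (W n)) (snd (W n)) g" for n
      proof -
        have "(fst (W n), snd (W n)) \<in> ?G" by (simp only: prod.collapse W(1))
        then show ?thesis unfolding Ta_inv_adjoint_iff[OF lin] by (rule conjunct2)
      qed
    qed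
    moreover have "(\<lambda>n. snd (W n)) \<longlonglongrightarrow> x'" using tendsto_snd[OF W(2)] by simp
    ultimately show ?thesis by (rule LIMSEQ_unique[symmetric])
  qed
  ultimately show ?thesis
    unfolding op_apply_def op_Ta_inv_adjoint_def by (rule the_equality)
qed

section \<open>The limit of vanishing regularization\<close>

text \<open>
  Testing the Euler equation with \<open>y - x\<^sub>a\<close> bounds \<open>\<parallel>x\<^sub>a\<parallel>\<close> by \<open>\<parallel>y\<parallel>\<close>, so that \<open>x\<^sub>a\<close> has a limit \<open>l\<close>,
  and shows that the residual \<open>f - A x\<^sub>a\<close> tends to \<open>0\<close>, so that \<open>A l = f\<close>. Testing it
  with \<open>y - l\<close>, an element of the null space, shows that \<open>l\<close> is orthogonal to \<open>y - l\<close>; so is \<open>y\<close>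
  by hypothesis.
\<close>

lemma tikhonov_tendsto_at_right_0:
  assumes lin: "linear_operator smul A" and "closed A"
    and yf: "(y, f) \<in> A" and orth: "\<forall>n \<in> null_space A. ip y n = 0"
    and tik: "\<And>a. a > 0 \<Longrightarrow> tikhonov A a f (x a) (g a)"
  shows "(x \<longlongrightarrow> y) (at_right 0)"
proof -
  have res: "(norm (f - g a))\<^sup>2 = a * re_ip (y - x a) (x a)" if "a > 0" for a
  proof -
    have "(y - x a, f - g a) \<in> A"
      using tik[OF that] linear_operator_diff[OF lin yf] by (auto simp: tikhonov_def)
    then show ?thesis
      using tikhonov_variation[OF lin tik[OF that]] by (simp flip: re_ip_self)
  qed
  have le: "norm (x a) \<le> norm y" if "a > 0" for a
  proof -
    have "0 \<le> a * re_ip (y - x a) (x a)" using res[OF that] by (metis zero_le_power2)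
    then have "(norm (x a))\<^sup>2 \<le> re_ip y (x a)"
      using that by (simp add: zero_le_mult_iff re_ip_diff_left re_ip_self)
    then have "norm (x a) * norm (x a) \<le> norm y * norm (x a)"
      using re_ip_le_norm_mult[of y "x a"] by (simp add: power2_eq_square)
    then show ?thesis
      by (metis mult_le_cancel_right norm_ge_zero norm_le_zero_iff not_less order_trans)
  qed
  obtain l where "((\<lambda>s. x (inverse s)) \<longlongrightarrow> l) at_top"
  proof (rule convergent_of_oscillation_le_bounded_increment
      [where p = "\<lambda>s. x (inverse s)" and \<phi> = "\<lambda>s. (norm (x (inverse s)))\<^sup>2" and B = "(norm y)\<^sup>2"])
    show "(norm (x (inverse s) - x (inverse t)))\<^sup>2 \<le> (norm (x (inverse t)))\<^sup>2 - (norm (x (inverse s)))\<^sup>2"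
      if "0 < s" "s \<le> t" for s t
      using that by (intro tikhonov_solution_osc[OF lin tik tik]) auto
  qed (use le in \<open>auto intro!: power_mono\<close>)
  then have l: "(x \<longlongrightarrow> l) (at_right 0)" by (simp add: filterlim_at_right_to_top)
  have pos: "\<forall>\<^sub>F a in at_right 0. (a::real) > 0" by (simp add: eventually_at_right_less)
  have "((\<lambda>a. a * re_ip (y - x a) (x a)) \<longlongrightarrow> 0 * re_ip (y - l) l) (at_right 0)"
    by (intro tendsto_intros l)
  then have "((\<lambda>a. (norm (f - g a))\<^sup>2) \<longlongrightarrow> 0) (at_right 0)"
    by (simp add: filterlim_cong[OF refl refl eventually_mono[OF pos res]])
  then have "((\<lambda>a. f - g a) \<longlongrightarrow> 0) (at_right 0)"
    by (rule tendsto_zero_if_norm_sq)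
  then have g: "(g \<longlongrightarrow> f) (at_right 0)"
    using tendsto_diff[OF tendsto_const[of f], of "\<lambda>a. f - g a" 0] by simp
  have "(l, f) \<in> A"
    by (rule Lim_in_closed_set[OF \<open>closed A\<close> _ _ tendsto_Pair[OF l g]])
      (use tik in \<open>auto intro!: eventually_mono[OF pos] simp: tikhonov_def\<close>)
  then have yl: "(y - l, 0) \<in> A" using linear_operator_diff[OF lin yf] by fastforce
  have "re_ip (y - l) (x a) = 0" if "a > 0" for a
    using tikhonov_variation[OF lin tik[OF that] yl] that by simp
  then have "((\<lambda>a. re_ip (y - l) (x a)) \<longlongrightarrow> 0) (at_right 0)"
    by (intro tendsto_eventually eventually_mono[OF pos])
  moreover have "((\<lambda>a. re_ip (y - l) (x a)) \<longlongrightarrow> re_ip (y - l) l) (at_right 0)"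
    by (intro tendsto_intros l)
  ultimately have "re_ip (y - l) l = 0" by (intro tendsto_unique[of "at_right 0"]) auto
  moreover have "re_ip (y - l) y = 0"
  proof -
    have ip0: "ip y (y - l) = 0" using orth yl by (auto simp: null_space_def)
    then have "ip (y - l) y = 0" using ip_conjugate[of "y - l" y] conjugate_of_real[of 0] by simp
    then have "(of_real (2 * re_ip (y - l) y) :: 'k) = of_real 0"
      unfolding of_real_re_ip using ip0 by simp
    then show ?thesis by simp
  qed
  ultimately have "re_ip (y - l) (y - l) = 0" by (simp add: re_ip_diff_right)
  then show ?thesis using l by (simp add: re_ip_self)
qed

end

theorem theorem5:
  fixes smul :: "'k::real_or_complex_field \<Rightarrow> 'h::banach \<Rightarrow> 'h"
    and ip :: "'h \<Rightarrow> 'h \<Rightarrow> 'k"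
    and A :: "'h rel"
    and y f :: 'h
    and a :: "real \<Rightarrow> real"
    and u :: "real \<Rightarrow> 'h"
  assumes "hilbert_space smul ip"
    and "linear_operator smul A" and "closed A" and "densely_defined A"
    and "y \<in> Domain A" and "\<forall>n \<in> null_space A. ip y n = 0"
    and "f = op_apply A y"
    and "\<forall>t \<ge> 0. a t > 0"
    and "antimono_on {0..} a" and "continuous_on {0..} a"
    and "(a \<longlongrightarrow> 0) at_top"
    and "filterlim (\<lambda>R. integral {0..R} a) at_top at_top"
    and "\<forall>t \<ge> 0. (u has_vector_derivative
           - u t + op_apply (op_Ta_inv_adjoint ip A (a t)) f) (at t within {0..})"
    and "u 0 = 0"
  shows "(u \<longlongrightarrow> y) at_top"
proof -
  interpret hilbert_space smul ip by fact
  obtain f' where f': "(y, f') \<in> A" using assms(5) by blast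
  then have "f = f'"
    using assms(2) the_equality[of "\<lambda>z. (y, z) \<in> A" f']
    unfolding assms(7) op_apply_def linear_operator_def single_valued_def by blast
  then have yf: "(y, f) \<in> A" using f' by simp
  have "\<exists>x g. tikhonov A b f x g" if "b > 0" for b
    using tikhonov_exists[OF assms(2,3) that] by blast
  then obtain x g where tik: "\<And>b. b > 0 \<Longrightarrow> tikhonov A b f (x b) (g b)" by metis
  have "filterlim a (at_right 0) at_top"
    using assms(8,11) 
    by (auto simp: filterlim_at intro!: eventually_at_top_linorderI[of 0] less_imp_neq[symmetric])
  then have lim: "((\<lambda>t. x (a t)) \<longlongrightarrow> y) at_top"
    using filterlim_compose[OF tikhonov_tendsto_at_right_0[OF assms(2,3) yf assms(6) tik]] by blast
  have "(u has_vector_derivative - u t + x (a t)) (at t within {0..})" if "t \<ge> 0" for t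
    using assms(8,13) that op_apply_Ta_inv_adjoint[OF assms(2,3) _ tik] by simp
  then show ?thesis using lim by (rule relaxation_tendsto)
qed

end
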